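(* Consider the private and complete information models for $\sigma$-correlated preferences, and for $\Gamma\in\{S,U,W\}$ let $U^\Gamma$ be the aggregate utility when all $N$ consumers use the equilibrium consumption of behavior model $\Gamma$. For large $N$ and $\bar g$, the following relations hold for both information models: 1. The ratio of expected aggregate utility when consumers act selfishly versus altruistically is $$\frac{E[U^S]}{E[U^U]}=\frac{4\alpha^2+4\alpha\gamma}{4\alpha^2+4\alpha\gamma+\gamma^2}.$$ That is, altruistic behavior achieves a strictly higher aggregate utility. 2. The ratio of expected aggregate utility when consumers act as welfare maximizers versus altruistically is $$\frac{E[U^W]}{E[U^U]}=\frac{(\gamma+\alpha)(2\kappa+\alpha-\gamma)}{(\kappa+\alpha)^2},$$ which is strictly less than $1$ for any parameter value $\gamma\neq\kappa$.
   Context: There are $N$ consumers. Constants $\gamma,\alpha,\kappa>0$, $\bar g>0$, $\sigma\in[0,1]$. The preference vector $(g_1,\dots,g_N)$ is normal with mean $\bar g\mathbf{1}$ and is $\sigma$-correlated: covariance matrix with diagonal entries $1$ and off-diagonal entries $\sigma$. $\omega$ is a real random variable with mean $\bar\omega$, independent of the preferences. When consumer $i$ consumes $s_i$, the aggregate utility is $$U=\sum_{i=1}^N\Big(-s_i\frac{\gamma}{N}\Big(\sum_{j=1}^Ns_j+\omega\Big)+g_is_i-\alpha s_i^2\Big).$$ Put $\lambda^S=\mu^S=\tau^S=\gamma/N$; $\lambda^U=2\gamma/N$, $\mu^U=\tau^U=\gamma/N$; $\lambda^W=2\kappa/N$, $\mu^W=0$, $\tau^W=\kappa/N$; $\rho^\Gamma=(2(\tau^\Gamma+\alpha))^{-1}$;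 $b^\Gamma=\rho^\Gamma(1+\lambda^\Gamma\rho^\Gamma(N-1))^{-1}$. The behavior models are: $S$ (selfish), $U$ (altruistic), $W$ (welfare-maximizing). The Bayesian Nash equilibrium consumptions are as follows. Private information (consumer $i$ knows only $g_i$): $s_i^\Gamma=a^\Gamma(g_i-\bar g)+b^\Gamma(\bar g-\bar\omega\mu^\Gamma)$ with $a^\Gamma=\rho^\Gamma(1+\lambda^\Gamma\rho^\Gamma\sigma(N-1))^{-1}$. Complete information (consumer $i$ knows $g_i$ and $\sum_jg_j$): $s_i^\Gamma=a^\Gamma(g_i-\frac1N\sum_jg_j)+b^\Gamma(\frac1N\sum_jg_j-\bar\omega\mu^\Gamma)$ with $a^\Gamma=\rho^\Gamma(1-\lambda^\Gamma\rho^\Gamma)^{-1}$. The relations "for large $N$ and $\bar g$" are obtained from the expression of $E[U]/N$ for $\bar\omega=0$ by keeping only the terms multiplying $\bar g^2$, namely $(b^\Gamma-(\gamma+\alpha)(b^\Gamma)^2)\bar g^2$, with the large-$N$ approximations $b^S\approx(\gamma+2\alpha)^{-1}$, $b^U\approx(2(\gamma+\alpha))^{-1}$, $b^W\approx(2(\kappa+\alpha))^{-1}$. *)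

theory Defs
  imports "HOL-Probability.Probability"
begin

section \<open>Jointly normal random vectors\<close>

text \<open>Point masses count as (degenerate) normal laws. They must be admitted below because
  a covariance matrix with unit diagonal and constant off-diagonal entry \<open>\<sigma>\<close> is singular
  for \<open>\<sigma> = 1\<close>.\<close>

definition normal_rv :: "'a measure \<Rightarrow> ('a \<Rightarrow> real) \<Rightarrow> bool" where
  "normal_rv M X \<longleftrightarrow> X \<in> borel_measurable M \<and>
     ((\<exists>m. AE x in M. X x = m) \<or>
      (\<exists>m s. 0 < s \<and> distributed M lborel X (normal_density m s)))"

definition jointly_normal :: "'a measure \<Rightarrow> nat \<Rightarrow> (nat \<Rightarrow> 'a \<Rightarrow> real) \<Rightarrow> bool" where
  "jointly_normal M n X \<longleftrightarrow> (\<forall>c. normal_rv M (\<lambda>x. \<Sum>i<n. c i * X i x))"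

definition covariance :: "'a measure \<Rightarrow> ('a \<Rightarrow> real) \<Rightarrow> ('a \<Rightarrow> real) \<Rightarrow> real" where
  "covariance M X Y =
     (\<integral>x. (X x - integral\<^sup>L M X) * (Y x - integral\<^sup>L M Y) \<partial>M)"


section \<open>Random environment\<close>

text \<open>The consumers are numbered \<open>0, \<dots>, N - 1\<close>; the values of \<open>g i\<close> for \<open>i \<ge> N\<close> are
  irrelevant. Independence of \<open>\<omega>\<close> from the whole preference vector is stated through the
  generated \<open>\<sigma>\<close>-algebras because \<open>indep_var\<close> requires both variables to have the same value
  type.\<close>

locale consumer_model = prob_space M
  for M :: "'a measure" +
  fixes N :: nat and \<sigma> gbar \<omega>bar :: real
    and g :: "nat \<Rightarrow> 'a \<Rightarrow> real" and \<omega> :: "'a \<Rightarrow> real"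
  assumes normal: "jointly_normal M N g"
    and mean: "\<And>i. i < N \<Longrightarrow> expectation (g i) = gbar"
    and cov: "\<And>i j. i < N \<Longrightarrow> j < N \<Longrightarrow>
      covariance M (g i) (g j) = (if i = j then 1 else \<sigma>)"
    and \<omega>_integrable: "integrable M \<omega>"
    and \<omega>_mean: "expectation \<omega> = \<omega>bar"
    and \<omega>_indep: "indep_set
      {\<omega> -` A \<inter> space M | A. A \<in> sets borel}
      {(\<lambda>x. \<lambda>i\<in>{..<N}. g i x) -` B \<inter> space M | B. B \<in> sets (Pi\<^sub>M {..<N} (\<lambda>_. borel))}"


section \<open>Equilibrium consumption and aggregate utility\<close>

datatype behavior = Selfish | Altruistic | Welfare

datatype information = Private | Complete

fun lambda_coef :: "real \<Rightarrow> real \<Rightarrow> nat \<Rightarrow> behavior \<Rightarrow> real" where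
  "lambda_coef \<gamma> \<kappa> N Selfish = \<gamma> / real N"
| "lambda_coef \<gamma> \<kappa> N Altruistic = 2 * \<gamma> / real N"
| "lambda_coef \<gamma> \<kappa> N Welfare = 2 * \<kappa> / real N"

fun mu_coef :: "real \<Rightarrow> nat \<Rightarrow> behavior \<Rightarrow> real" where
  "mu_coef \<gamma> N Selfish = \<gamma> / real N"
| "mu_coef \<gamma> N Altruistic = \<gamma> / real N"
| "mu_coef \<gamma> N Welfare = 0"

fun tau_coef :: "real \<Rightarrow> real \<Rightarrow> nat \<Rightarrow> behavior \<Rightarrow> real" where
  "tau_coef \<gamma> \<kappa> N Selfish = \<gamma> / real N"
| "tau_coef \<gamma> \<kappa> N Altruistic = \<gamma> / real N"
| "tau_coef \<gamma> \<kappa> N Welfare = \<kappa> / real N"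

definition rho_coef :: "real \<Rightarrow> real \<Rightarrow> real \<Rightarrow> nat \<Rightarrow> behavior \<Rightarrow> real" where
  "rho_coef \<gamma> \<alpha> \<kappa> N \<Gamma> = inverse (2 * (tau_coef \<gamma> \<kappa> N \<Gamma> + \<alpha>))"

definition b_coef :: "real \<Rightarrow> real \<Rightarrow> real \<Rightarrow> nat \<Rightarrow> behavior \<Rightarrow> real" where
  "b_coef \<gamma> \<alpha> \<kappa> N \<Gamma> = rho_coef \<gamma> \<alpha> \<kappa> N \<Gamma> *
     inverse (1 + lambda_coef \<gamma> \<kappa> N \<Gamma> * rho_coef \<gamma> \<alpha> \<kappa> N \<Gamma> * (real N - 1))"

fun a_coef ::
  "information \<Rightarrow> real \<Rightarrow> real \<Rightarrow> real \<Rightarrow> real \<Rightarrow> nat \<Rightarrow> behavior \<Rightarrow> real" where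
  "a_coef Private \<gamma> \<alpha> \<kappa> \<sigma> N \<Gamma> = rho_coef \<gamma> \<alpha> \<kappa> N \<Gamma> *
     inverse (1 + lambda_coef \<gamma> \<kappa> N \<Gamma> * rho_coef \<gamma> \<alpha> \<kappa> N \<Gamma> * \<sigma> * (real N - 1))"
| "a_coef Complete \<gamma> \<alpha> \<kappa> \<sigma> N \<Gamma> = rho_coef \<gamma> \<alpha> \<kappa> N \<Gamma> *
     inverse (1 - lambda_coef \<gamma> \<kappa> N \<Gamma> * rho_coef \<gamma> \<alpha> \<kappa> N \<Gamma>)"

text \<open>The Bayesian Nash equilibrium consumption of consumer \<open>i\<close>, as a function of the realized
  preference vector \<open>v\<close>.\<close>

fun equilibrium_consumption ::
  "information \<Rightarrow> real \<Rightarrow> real \<Rightarrow> real \<Rightarrow> real \<Rightarrow> real \<Rightarrow> real \<Rightarrow> nat \<Rightarrow> behavior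
     \<Rightarrow> (nat \<Rightarrow> real) \<Rightarrow> nat \<Rightarrow> real" where
  "equilibrium_consumption Private \<gamma> \<alpha> \<kappa> \<sigma> gbar \<omega>bar N \<Gamma> v i =
     a_coef Private \<gamma> \<alpha> \<kappa> \<sigma> N \<Gamma> * (v i - gbar)
     + b_coef \<gamma> \<alpha> \<kappa> N \<Gamma> * (gbar - \<omega>bar * mu_coef \<gamma> N \<Gamma>)"
| "equilibrium_consumption Complete \<gamma> \<alpha> \<kappa> \<sigma> gbar \<omega>bar N \<Gamma> v i =
     a_coef Complete \<gamma> \<alpha> \<kappa> \<sigma> N \<Gamma> * (v i - 1 / real N * (\<Sum>j<N. v j))
     + b_coef \<gamma> \<alpha> \<kappa> N \<Gamma> * (1 / real N * (\<Sum>j<N. v j) - \<omega>bar * mu_coef \<gamma> N \<Gamma>)"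

definition aggregate_utility ::
  "real \<Rightarrow> real \<Rightarrow> nat \<Rightarrow> (nat \<Rightarrow> real) \<Rightarrow> real \<Rightarrow> (nat \<Rightarrow> real) \<Rightarrow> real" where
  "aggregate_utility \<gamma> \<alpha> N v w s =
     (\<Sum>i<N. - s i * (\<gamma> / real N) * ((\<Sum>j<N. s j) + w) + v i * s i - \<alpha> * (s i)\<^sup>2)"

definition expected_utility ::
  "information \<Rightarrow> real \<Rightarrow> real \<Rightarrow> real \<Rightarrow> real \<Rightarrow> real \<Rightarrow> real \<Rightarrow> nat \<Rightarrow> behavior
     \<Rightarrow> 'a measure \<Rightarrow> (nat \<Rightarrow> 'a \<Rightarrow> real) \<Rightarrow> ('a \<Rightarrow> real) \<Rightarrow> real" where
  "expected_utility info \<gamma> \<alpha> \<kappa> \<sigma> gbar \<omega>bar N \<Gamma> M g \<omega> =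
     (\<integral>x. aggregate_utility \<gamma> \<alpha> N (\<lambda>i. g i x) (\<omega> x)
        (equilibrium_consumption info \<gamma> \<alpha> \<kappa> \<sigma> gbar \<omega>bar N \<Gamma> (\<lambda>i. g i x)) \<partial>M)"

end

theory Submission imports Defs "HOL-Real_Asymp.Real_Asymp" begin

text \<open>In both information models the consumption has the form
  \<open>s\<^sub>i = p X\<^sub>i + q S / N + \<beta>\<close> with \<open>X\<^sub>i = g\<^sub>i - gbar\<close>, \<open>S = \<Sum>\<^sub>j X\<^sub>j\<close> and a deterministic \<open>\<beta>\<close>,
  so the aggregate utility is affine in \<open>S\<close>, \<open>S\<^sup>2\<close>, \<open>\<Sum>\<^sub>i X\<^sub>i\<^sup>2\<close>, \<open>S \<omega>\<close> and \<open>\<omega>\<close>, and its mean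
  involves only the first two moments. The moments of \<open>X\<close> contribute a term of \<open>E[U] / N\<close> that
  does not depend on \<open>gbar\<close> and converges as \<open>N\<close> grows, whereas \<open>\<beta> / gbar\<close> tends to the
  limit \<open>b\<close> of the coefficient \<open>b\<^sup>\<Gamma>\<close>. Hence \<open>E[U] / (N gbar\<^sup>2)\<close> tends to
  \<open>b - (\<gamma> + \<alpha>) b\<^sup>2\<close>, which is maximal exactly at the altruistic value
  \<open>b = 1 / (2 (\<gamma> + \<alpha>))\<close>.\<close>

text \<open>Preimages of a sigma-algebra already form a sigma-algebra. This reconciles
  \<open>indep_var_eq\<close>, which speaks of generated sigma-algebras, with the plain families of
  preimages in \<open>\<omega>_indep\<close>.\<close>

lemma sigma_sets_vimage_sets:
  assumes "X \<in> measurable M S"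
  shows "sigma_sets (space M) {X -` A \<inter> space M | A. A \<in> sets S} = {X -` A \<inter> space M | A. A \<in> sets S}"
  using sigma_sets_vimage_commute[of X "space M" "space S" "sets S"] measurable_space[OF assms]
  by (simp add: sets.sigma_sets_eq Pi_iff)

section \<open>Pathwise algebra of consumption and aggregate utility\<close>

text \<open>The weight \<open>q\<close> of the average deviation \<open>S / N\<close>. Under
  complete information the sample average enters with weight \<open>b\<close> directly and with
  weight \<open>- a\<close> through the deviation from it; under private information it does not
  enter.\<close>

fun spread_coef :: "information \<Rightarrow> real \<Rightarrow> real \<Rightarrow> real \<Rightarrow> real \<Rightarrow> nat \<Rightarrow> behavior \<Rightarrow> real" where
  "spread_coef Private \<gamma> \<alpha> \<kappa> \<sigma> N \<Gamma> = 0"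
| "spread_coef Complete \<gamma> \<alpha> \<kappa> \<sigma> N \<Gamma> = b_coef \<gamma> \<alpha> \<kappa> N \<Gamma> - a_coef Complete \<gamma> \<alpha> \<kappa> \<sigma> N \<Gamma>"

lemma equilibrium_consumption_centred:
  assumes "N > 0"
  shows "equilibrium_consumption info \<gamma> \<alpha> \<kappa> \<sigma> gbar \<omega>bar N \<Gamma> v i =
    a_coef info \<gamma> \<alpha> \<kappa> \<sigma> N \<Gamma> * (v i - gbar)
    + spread_coef info \<gamma> \<alpha> \<kappa> \<sigma> N \<Gamma> / real N * (\<Sum>j<N. v j - gbar)
    + b_coef \<gamma> \<alpha> \<kappa> N \<Gamma> * (gbar - \<omega>bar * mu_coef \<gamma> N \<Gamma>)"
proof (cases info)
  case Complete
  have "(\<Sum>j<N. v j) = (\<Sum>j<N. v j - gbar) + N * gbar"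
    by (simp add: sum_subtractf)
  then show ?thesis
    using assms Complete by (simp add: field_simps del: a_coef.simps)
qed simp

text \<open>Consumption is \<open>p * X i + r\<close> with \<open>r = q / N * S + \<beta>\<close>
  the same for all consumers, so the sums of \<open>s i\<close>, \<open>v i * s i\<close> and
  \<open>(s i)\<^sup>2\<close> depend on the deviations only through their sum and their sum of
  squares. The result is grouped so that each random factor has a mean known from the model.\<close>

lemma aggregate_utility_affine:
  fixes v :: "nat \<Rightarrow> real" and m :: real
  assumes N: "N > 0"
  defines "S \<equiv> (\<Sum>i<N. v i - m)"
  shows "aggregate_utility \<gamma> \<alpha> N v w (\<lambda>i. p * (v i - m) + q / real N * S + \<beta>) =
    (\<beta> + m * (p + q) - 2 * (\<gamma> + \<alpha>) * (p + q) * \<beta>) * S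
    + (q - \<gamma> * (p + q)\<^sup>2 - \<alpha> * (2 * p * q + q\<^sup>2)) / N * S\<^sup>2
    + (p - \<alpha> * p\<^sup>2) * (\<Sum>i<N. (v i - m)\<^sup>2)
    - \<gamma> * (p + q) / N * (S * w)
    - \<gamma> * \<beta> * w
    + N * (m * \<beta> - (\<gamma> + \<alpha>) * \<beta>\<^sup>2)"
proof -
  define X where "X = (\<lambda>i. v i - m)"
  define r where "r = q / N * S + \<beta>"
  define Q where "Q = (\<Sum>i<N. (X i)\<^sup>2)"
  define s where "s = (\<lambda>i. p * X i + r)"
  have SX: "(\<Sum>i<N. X i) = S" by (simp add: X_def S_def)
  have T: "(\<Sum>i<N. s i) = p * S + N * r"
    by (simp add: s_def sum.distrib SX flip: sum_distrib_left)
  have "(\<Sum>i<N. v i * s i) = (\<Sum>i<N. p * (X i)\<^sup>2 + r * X i + m * s i)"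
    by (rule sum.cong) (auto simp: s_def X_def power2_eq_square algebra_simps)
  then have vs: "(\<Sum>i<N. v i * s i) = p * Q + r * S + m * (p * S + N * r)"
    by (simp add: sum.distrib Q_def SX T flip: sum_distrib_left)
  have "(\<Sum>i<N. (s i)\<^sup>2) = (\<Sum>i<N. p\<^sup>2 * (X i)\<^sup>2 + 2 * p * r * X i + r\<^sup>2)"
    by (rule sum.cong) (auto simp: s_def power2_eq_square algebra_simps)
  then have ss: "(\<Sum>i<N. (s i)\<^sup>2) = p\<^sup>2 * Q + 2 * p * r * S + N * r\<^sup>2"
    by (simp add: sum.distrib Q_def SX flip: sum_distrib_left)
  have "aggregate_utility \<gamma> \<alpha> N v w s =
      - (\<gamma> / N) * ((\<Sum>i<N. s i) + w) * (\<Sum>i<N. s i) + (\<Sum>i<N. v i * s i) - \<alpha> * (\<Sum>i<N. (s i)\<^sup>2)"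
    unfolding aggregate_utility_def sum_distrib_left
    by (simp add: sum.distrib sum_subtractf sum_negf add_divide_distrib algebra_simps)
  also have "\<dots> = - (\<gamma> / N) * (p * S + N * r + w) * (p * S + N * r)
      + (p * Q + r * S + m * (p * S + N * r)) - \<alpha> * (p\<^sup>2 * Q + 2 * p * r * S + N * r\<^sup>2)"
    by (simp only: T vs ss)
  also have "\<dots> = (\<beta> + m * (p + q) - 2 * (\<gamma> + \<alpha>) * (p + q) * \<beta>) * S
    + (q - \<gamma> * (p + q)\<^sup>2 - \<alpha> * (2 * p * q + q\<^sup>2)) / N * S\<^sup>2
    + (p - \<alpha> * p\<^sup>2) * Q
    - \<gamma> * (p + q) / N * (S * w)
    - \<gamma> * \<beta> * w
    + N * (m * \<beta> - (\<gamma> + \<alpha>) * \<beta>\<^sup>2)"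
  proof -
    \<comment> \<open>Replacing \<open>S\<close> by \<open>k * N\<close> removes every division by
      \<open>N\<close>, so that the claim becomes a polynomial identity.\<close>
    define k where "k = S / N"
    have S: "S = k * N"
      using N by (simp add: k_def)
    have "- (\<gamma> / N) * (p * S + N * r + w) * (p * S + N * r)
        = - \<gamma> * (p * k + r) * (p * S + N * r + w)"
      using N by (simp add: S field_simps)
    moreover have "a / N * S\<^sup>2 = a * k * S" "\<gamma> * (p + q) / N * (S * w) = \<gamma> * (p + q) * (k * w)" for a
      by (simp_all add: k_def power2_eq_square)
    moreover have "r = q * k + \<beta>"
      by (simp add: r_def k_def)
    ultimately show ?thesis
      by (simp only:) (simp add: S power2_eq_square algebra_simps)
  qed
  finally show ?thesis
    by (simp add: s_def r_def Q_def X_def S_def add.assoc)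
qed

section \<open>Moments of the preferences and the exact expected utility\<close>

context consumer_model
begin

text \<open>Integrability comes from the junk value: a non-integrable function has Bochner
  integral \<open>0\<close>, which would contradict the mean \<open>gbar \<noteq> 0\<close> here and the variance \<open>1\<close> in
  the next lemma.\<close>

lemma preference_integrable:
  assumes "gbar \<noteq> 0" "i < N"
  shows "integrable M (g i)"
  using mean[OF assms(2)] assms(1) not_integrable_integral_eq by fastforce

lemma square_deviation_integrable:
  assumes "i < N"
  shows "integrable M (\<lambda>x. (g i x - gbar)\<^sup>2)"
proof (rule ccontr)
  assume "\<not> ?thesis"
  then have "expectation (\<lambda>x. (g i x - gbar)\<^sup>2) = 0"
    by (rule not_integrable_integral_eq)
  then show False
    using cov[of i i] assms by (simp add: covariance_def mean power2_eq_square)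
qed

lemma has_mean_deviation:
  assumes "gbar \<noteq> 0" "i < N"
  shows "has_bochner_integral M (\<lambda>x. g i x - gbar) 0"
  using preference_integrable[OF assms] mean[OF assms(2)]
  by (simp add: has_bochner_integral_iff prob_space)

text \<open>The value is the covariance assumption, but that alone does not give integrability: for
  \<sigma> = 0 the integral would also be 0 for a non-integrable product. Hence the product is first
  dominated by the sum of the two squared deviations.\<close>

lemma has_covariance:
  assumes "gbar \<noteq> 0" "i < N" "j < N"
  shows "has_bochner_integral M (\<lambda>x. (g i x - gbar) * (g j x - gbar)) (if i = j then 1 else \<sigma>)"
proof -
  note [measurable] = borel_measurable_integrable[OF preference_integrable[OF assms(1,2)]]
    borel_measurable_integrable[OF preference_integrable[OF assms(1,3)]]
  have "integrable M (\<lambda>x. (g i x - gbar)\<^sup>2 + (g j x - gbar)\<^sup>2)"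
    using assms square_deviation_integrable by (intro Bochner_Integration.integrable_add)
  then have "integrable M (\<lambda>x. (g i x - gbar) * (g j x - gbar))"
  proof (rule Bochner_Integration.integrable_bound)
    have "\<bar>a * b\<bar> \<le> \<bar>a\<^sup>2 + b\<^sup>2\<bar>" for a b :: real
    proof -
      have "2 * \<bar>a * b\<bar> \<le> a\<^sup>2 + b\<^sup>2"
        using sum_squares_bound[of "\<bar>a\<bar>" "\<bar>b\<bar>"] by (simp add: abs_mult)
      then show ?thesis by linarith
    qed
    then show "AE x in M. norm ((g i x - gbar) * (g j x - gbar))
        \<le> norm ((g i x - gbar)\<^sup>2 + (g j x - gbar)\<^sup>2)"
      by simp
  qed measurable
  then show ?thesis
    using cov[OF assms(2,3)] assms by (simp add: covariance_def mean has_bochner_integral_iff)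
qed

text \<open>Each \<open>g i\<close> is a coordinate projection of the preference vector, so its
  events are among those of the vector, and independence passes to the smaller family.\<close>

lemma preference_shock_indep:
  assumes "gbar \<noteq> 0" "i < N"
  shows "indep_var borel (g i) borel \<omega>"
proof -
  have meas: "g j \<in> borel_measurable M" if "j < N" for j
    using preference_integrable[OF assms(1) that] by simp
  have \<omega>: "\<omega> \<in> borel_measurable M"
    using \<omega>_integrable by simp
  let ?G = "\<lambda>x. \<lambda>i\<in>{..<N}. g i x"
  have sub: "{g i -` A \<inter> space M | A. A \<in> sets borel}
      \<subseteq> {?G -` B \<inter> space M | B. B \<in> sets (Pi\<^sub>M {..<N} (\<lambda>_. borel))}"
  proof safe
    fix A :: "real set" assume A: "A \<in> sets borel"
    \<comment> \<open>The cylinder over \<open>A\<close> in coordinate \<open>i\<close>; its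
      preimage under the whole vector is the preimage of \<open>A\<close> under
      \<open>g i\<close>.\<close>
    let ?B = "(\<lambda>f. f i) -` A \<inter> space (Pi\<^sub>M {..<N} (\<lambda>_. borel :: real measure))"
    have "(\<lambda>f. f i) \<in> measurable (Pi\<^sub>M {..<N} (\<lambda>_. borel :: real measure)) borel"
      using assms(2) by (intro measurable_component_singleton) auto
    then have "?B \<in> sets (Pi\<^sub>M {..<N} (\<lambda>_. borel))"
      using A by (rule measurable_sets)
    moreover have "g i -` A \<inter> space M = ?G -` ?B \<inter> space M"
      using assms(2) by (auto simp: space_PiM)
    ultimately show "\<exists>B. g i -` A \<inter> space M = ?G -` B \<inter> space M \<and> B \<in> sets (Pi\<^sub>M {..<N} (\<lambda>_. borel))"
      by blast
  qed
  have "indep_set {\<omega> -` A \<inter> space M | A. A \<in> sets borel} {g i -` A \<inter> space M | A. A \<in> sets borel}"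
    using \<omega>_indep sub unfolding indep_set_def
    by (elim indep_sets_mono_sets) (auto split: bool.split)
  then have "indep_set {g i -` A \<inter> space M | A. A \<in> sets borel} {\<omega> -` A \<inter> space M | A. A \<in> sets borel}"
    unfolding indep_sets2_eq by (metis (no_types, lifting) Int_commute mult.commute)
  then show ?thesis
    using meas[OF assms(2)] \<omega> by (simp add: indep_var_eq sigma_sets_vimage_sets)
qed

text \<open>By independence \<open>g i x * \<omega> x\<close> has mean
  \<open>gbar * \<omega>bar\<close>, which is exactly the mean of
  \<open>gbar * \<omega> x\<close>.\<close>

lemma has_mean_deviation_shock:
  assumes "gbar \<noteq> 0" "i < N"
  shows "has_bochner_integral M (\<lambda>x. (g i x - gbar) * \<omega> x) 0"
proof -
  note indep = preference_shock_indep[OF assms] preference_integrable[OF assms] \<omega>_integrable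
  have "has_bochner_integral M (\<lambda>x. g i x * \<omega> x) (gbar * \<omega>bar)"
    using indep_var_integrable[OF indep] indep_var_lebesgue_integral[OF indep] assms
    by (simp add: has_bochner_integral_iff mean \<omega>_mean)
  moreover have "has_bochner_integral M (\<lambda>x. gbar * \<omega> x) (gbar * \<omega>bar)"
    using \<omega>_integrable by (simp add: has_bochner_integral_iff \<omega>_mean)
  ultimately have "has_bochner_integral M (\<lambda>x. g i x * \<omega> x - gbar * \<omega> x) (gbar * \<omega>bar - gbar * \<omega>bar)"
    by (rule has_bochner_integral_diff)
  then show ?thesis
    by (simp add: left_diff_distrib)
qed

text \<open>Expanding the square gives the sum of all entries of the covariance matrix, each of
  whose \<open>N\<close> rows sums to \<open>1 + (N - 1) * \<sigma>\<close>.\<close>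

lemma has_mean_square_total_deviation:
  assumes "gbar \<noteq> 0"
  shows "has_bochner_integral M (\<lambda>x. (\<Sum>i<N. g i x - gbar)\<^sup>2) (real N * (1 + (real N - 1) * \<sigma>))"
proof -
  have row: "(\<Sum>j<N. if i = j then 1 else \<sigma>) = 1 + (real N - 1) * \<sigma>" if "i < N" for i
  proof -
    have "(\<Sum>j<N. if i = j then 1 else \<sigma>) = (\<Sum>j<N. \<sigma> + (if i = j then 1 - \<sigma> else 0))"
      by (rule sum.cong) auto
    then show ?thesis
      using that by (simp add: sum.distrib algebra_simps)
  qed
  have "has_bochner_integral M (\<lambda>x. \<Sum>i<N. \<Sum>j<N. (g i x - gbar) * (g j x - gbar))
      (\<Sum>i<N. \<Sum>j<N. if i = j then 1 else \<sigma>)"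
    by (intro has_bochner_integral_sum has_covariance assms) auto
  then show ?thesis
    by (simp add: row power2_eq_square sum_product)
qed

text \<open>Exact for every positive \<open>N\<close>. In the affine form the terms in
  \<open>S\<close> and \<open>S * \<omega>\<close> have mean 0, so only the two quadratic terms, the
  mean of \<omega> and the deterministic part remain. Since \<open>p\<close> and \<open>q\<close> do
  not involve \<open>gbar\<close>, it enters through \<beta> and its explicit factor only.\<close>

lemma expected_utility_eq:
  fixes \<gamma> \<alpha> \<kappa> :: real and info :: information and \<Gamma> :: behavior
  assumes "gbar \<noteq> 0" "N > 0"
  defines "p \<equiv> a_coef info \<gamma> \<alpha> \<kappa> \<sigma> N \<Gamma>" and "q \<equiv> spread_coef info \<gamma> \<alpha> \<kappa> \<sigma> N \<Gamma>"
    and "\<beta> \<equiv> b_coef \<gamma> \<alpha> \<kappa> N \<Gamma> * (gbar - \<omega>bar * mu_coef \<gamma> N \<Gamma>)"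
  shows "expected_utility info \<gamma> \<alpha> \<kappa> \<sigma> gbar \<omega>bar N \<Gamma> M g \<omega> =
    real N * ((q - \<gamma> * (p + q)\<^sup>2 - \<alpha> * (2 * p * q + q\<^sup>2)) * ((1 + (real N - 1) * \<sigma>) / real N)
      + (p - \<alpha> * p\<^sup>2) + (gbar * \<beta> - (\<gamma> + \<alpha>) * \<beta>\<^sup>2) - \<gamma> * \<beta> * \<omega>bar / real N)"
proof -
  let ?S = "\<lambda>x. \<Sum>i<N. g i x - gbar"
  have S: "has_bochner_integral M ?S 0"
    using has_bochner_integral_sum[of "{..<N}" M "\<lambda>i x. g i x - gbar" "\<lambda>_. 0"]
      has_mean_deviation[OF assms(1)] by simp
  have S\<omega>: "has_bochner_integral M (\<lambda>x. ?S x * \<omega> x) 0"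
    using has_bochner_integral_sum[of "{..<N}" M "\<lambda>i x. (g i x - gbar) * \<omega> x" "\<lambda>_. 0"]
      has_mean_deviation_shock[OF assms(1)] by (simp add: sum_distrib_right)
  have Q: "has_bochner_integral M (\<lambda>x. \<Sum>i<N. (g i x - gbar)\<^sup>2) (real N)"
    using has_bochner_integral_sum[of "{..<N}" M "\<lambda>i x. (g i x - gbar)\<^sup>2" "\<lambda>_. 1"]
      has_covariance[OF assms(1), of i i for i] by (simp add: power2_eq_square)
  have \<omega>: "has_bochner_integral M \<omega> \<omega>bar"
    using \<omega>_integrable \<omega>_mean by (simp add: has_bochner_integral_iff)
  have const: "has_bochner_integral M (\<lambda>_. c) c" for c :: real
    by (simp add: has_bochner_integral_iff prob_space)
  note lin = has_bochner_integral_add has_bochner_integral_diff has_bochner_integral_mult_right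
  \<comment> \<open>The value keeps the summands that vanish, so that it mirrors the affine form
    term by term and the linearity rules apply directly.\<close>
  have "has_bochner_integral M
    (\<lambda>x. aggregate_utility \<gamma> \<alpha> N (\<lambda>i. g i x) (\<omega> x)
        (equilibrium_consumption info \<gamma> \<alpha> \<kappa> \<sigma> gbar \<omega>bar N \<Gamma> (\<lambda>i. g i x)))
    ((\<beta> + gbar * (p + q) - 2 * (\<gamma> + \<alpha>) * (p + q) * \<beta>) * 0
    + (q - \<gamma> * (p + q)\<^sup>2 - \<alpha> * (2 * p * q + q\<^sup>2)) / N * (real N * (1 + (real N - 1) * \<sigma>))
    + (p - \<alpha> * p\<^sup>2) * N - \<gamma> * (p + q) / N * 0 - \<gamma> * \<beta> * \<omega>bar
    + N * (gbar * \<beta> - (\<gamma> + \<alpha>) * \<beta>\<^sup>2))"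
    unfolding equilibrium_consumption_centred[OF assms(2)] p_def[symmetric] q_def[symmetric]
      \<beta>_def[symmetric] aggregate_utility_affine[OF assms(2)]
    by (intro lin S S\<omega> Q \<omega> const has_mean_square_total_deviation assms(1))
  then have "expected_utility info \<gamma> \<alpha> \<kappa> \<sigma> gbar \<omega>bar N \<Gamma> M g \<omega> =
    (q - \<gamma> * (p + q)\<^sup>2 - \<alpha> * (2 * p * q + q\<^sup>2)) / N * (real N * (1 + (real N - 1) * \<sigma>))
    + (p - \<alpha> * p\<^sup>2) * N - \<gamma> * \<beta> * \<omega>bar + N * (gbar * \<beta> - (\<gamma> + \<alpha>) * \<beta>\<^sup>2)"
    unfolding expected_utility_def by (simp add: has_bochner_integral_integral_eq)
  moreover have "A / n * (n * V) + C * n - D + n * E = n * (A * (V / n) + C + E - D / n)"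
    if "n > 0" for A V C D E n :: real
    using that by (simp add: field_simps)
  ultimately show ?thesis
    using assms(2) by simp
qed

end

section \<open>Limits of the coefficients and of the normalised expected utility\<close>

context
  fixes \<gamma> \<alpha> \<kappa> :: real
  assumes pos: "\<gamma> > 0" "\<alpha> > 0" "\<kappa> > 0"
begin

text \<open>The constant value of \<open>N \<lambda>\<^sup>\<Gamma>\<close>.\<close>

fun limit_slope :: "behavior \<Rightarrow> real" where
  "limit_slope Selfish = \<gamma>"
| "limit_slope Altruistic = 2 * \<gamma>"
| "limit_slope Welfare = 2 * \<kappa>"

lemma limit_slope_pos: "limit_slope \<Gamma> > 0"
  using pos by (cases \<Gamma>) auto

lemma lambda_coef_eq: "lambda_coef \<gamma> \<kappa> N \<Gamma> = limit_slope \<Gamma> / real N"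
  by (cases \<Gamma>) auto

lemma lambda_coef_tendsto: "(\<lambda>N. lambda_coef \<gamma> \<kappa> N \<Gamma>) \<longlonglongrightarrow> 0"
  unfolding lambda_coef_eq by real_asymp

lemma mu_coef_tendsto: "(\<lambda>N. mu_coef \<gamma> N \<Gamma>) \<longlonglongrightarrow> 0"
  by (cases \<Gamma>) (simp_all, real_asymp+)

lemma rho_coef_tendsto: "(\<lambda>N. rho_coef \<gamma> \<alpha> \<kappa> N \<Gamma>) \<longlonglongrightarrow> inverse (2 * \<alpha>)"
proof -
  have "(\<lambda>N. tau_coef \<gamma> \<kappa> N \<Gamma>) \<longlonglongrightarrow> 0"
    by (cases \<Gamma>) (simp_all, real_asymp+)
  then have "(\<lambda>N. rho_coef \<gamma> \<alpha> \<kappa> N \<Gamma>) \<longlonglongrightarrow> inverse (2 * (0 + \<alpha>))"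
    unfolding rho_coef_def using pos by (intro tendsto_intros) auto
  then show ?thesis by simp
qed

text \<open>The coefficient \<open>lambda_coef\<close> is of order \<open>1 / N\<close>, and the
  factor \<open>N - 1\<close> compensates this: their product tends to
  \<open>limit_slope \<Gamma>\<close>. Nonnegative \<sigma> keeps the limiting denominator
  positive.\<close>

lemma private_coef_tendsto:
  assumes "\<sigma> \<ge> 0"
  shows "(\<lambda>N. rho_coef \<gamma> \<alpha> \<kappa> N \<Gamma> *
      inverse (1 + lambda_coef \<gamma> \<kappa> N \<Gamma> * rho_coef \<gamma> \<alpha> \<kappa> N \<Gamma> * \<sigma> * (real N - 1)))
    \<longlonglongrightarrow> inverse (2 * \<alpha> + limit_slope \<Gamma> * \<sigma>)"
proof -
  have "(\<lambda>N. lambda_coef \<gamma> \<kappa> N \<Gamma> * (real N - 1)) \<longlonglongrightarrow> limit_slope \<Gamma>"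
    unfolding lambda_coef_eq by real_asymp
  moreover have "1 + limit_slope \<Gamma> * inverse (2 * \<alpha>) * \<sigma> > 0"
    using pos limit_slope_pos[of \<Gamma>] assms by (intro add_pos_nonneg) auto
  ultimately have "(\<lambda>N. rho_coef \<gamma> \<alpha> \<kappa> N \<Gamma> *
      inverse (1 + (lambda_coef \<gamma> \<kappa> N \<Gamma> * (real N - 1)) * rho_coef \<gamma> \<alpha> \<kappa> N \<Gamma> * \<sigma>))
    \<longlonglongrightarrow> inverse (2 * \<alpha>) * inverse (1 + limit_slope \<Gamma> * inverse (2 * \<alpha>) * \<sigma>)"
    by (intro tendsto_intros rho_coef_tendsto) auto
  moreover have "inverse (2 * \<alpha>) * inverse (1 + limit_slope \<Gamma> * inverse (2 * \<alpha>) * \<sigma>)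
      = inverse (2 * \<alpha> + limit_slope \<Gamma> * \<sigma>)"
    using pos by (simp add: field_simps flip: inverse_mult_distrib)
  ultimately show ?thesis
    by (simp add: mult_ac)
qed

text \<open>The coefficient \<open>b\<close> is the private coefficient \<open>a\<close> at \<sigma>
  = 1. The limits are the approximations 1/(\<gamma> + 2\<alpha>), 1/(2(\<gamma> + \<alpha>)) and
  1/(2(\<kappa> + \<alpha>)).\<close>

lemma b_coef_tendsto: "(\<lambda>N. b_coef \<gamma> \<alpha> \<kappa> N \<Gamma>) \<longlonglongrightarrow> inverse (2 * \<alpha> + limit_slope \<Gamma>)"
  using private_coef_tendsto[of 1 \<Gamma>] by (simp add: b_coef_def)

text \<open>Mere existence of a limit is enough, because the terms built from this coefficient are
  later divided by \<open>gbar\<^sup>2\<close>.\<close>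

lemma a_coef_convergent:
  assumes "\<sigma> \<ge> 0"
  shows "convergent (\<lambda>N. a_coef info \<gamma> \<alpha> \<kappa> \<sigma> N \<Gamma>)"
proof (cases info)
  case Private
  then show ?thesis
    using private_coef_tendsto[OF assms, of \<Gamma>] by (auto simp: convergent_def)
next
  case Complete
  have "(\<lambda>N. rho_coef \<gamma> \<alpha> \<kappa> N \<Gamma> *
      inverse (1 - lambda_coef \<gamma> \<kappa> N \<Gamma> * rho_coef \<gamma> \<alpha> \<kappa> N \<Gamma>))
    \<longlonglongrightarrow> inverse (2 * \<alpha>) * inverse (1 - 0 * inverse (2 * \<alpha>))"
    by (intro tendsto_intros rho_coef_tendsto lambda_coef_tendsto) auto
  then show ?thesis
    using Complete by (auto simp: convergent_def)
qed

lemma spread_coef_convergent: "convergent (\<lambda>N. spread_coef info \<gamma> \<alpha> \<kappa> \<sigma> N \<Gamma>)"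
proof (cases info)
  case Complete
  \<comment> \<open>The complete-information coefficient does not contain \<sigma>, so the instance
    at 0 is the same sequence.\<close>
  have "convergent (\<lambda>N. a_coef Complete \<gamma> \<alpha> \<kappa> \<sigma> N \<Gamma>)"
    using a_coef_convergent[of 0 Complete] by simp
  then show ?thesis
    using Complete b_coef_tendsto[of \<Gamma>] by (auto simp: convergent_def intro: tendsto_diff)
qed (simp add: convergent_const)

text \<open>Along the product filter \<open>N\<close> and \<open>gbar\<close> grow with no
  prescribed relation between them. This is harmless because the moment part \<open>H\<close>
  depends on \<open>N\<close> alone and converges, so its quotient by \<open>gbar\<^sup>2\<close>
  vanishes however the two grow.\<close>

lemma expected_utility_asymptotics:
  fixes M :: "nat \<Rightarrow> real \<Rightarrow> 'a measure" and \<Gamma> :: behavior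
  assumes "\<sigma> \<ge> 0"
    and model: "\<And>N gbar. N \<ge> 1 \<Longrightarrow> gbar > 0 \<Longrightarrow>
      consumer_model (M N gbar) N \<sigma> gbar \<omega>bar (g N gbar) (\<omega> N gbar)"
  defines "b \<equiv> inverse (2 * \<alpha> + limit_slope \<Gamma>)"
  shows "((\<lambda>(N, gbar). expected_utility info \<gamma> \<alpha> \<kappa> \<sigma> gbar \<omega>bar N \<Gamma>
      (M N gbar) (g N gbar) (\<omega> N gbar) / (real N * gbar\<^sup>2)) \<longlongrightarrow> b - (\<gamma> + \<alpha>) * b\<^sup>2)
    (sequentially \<times>\<^sub>F at_top)"
proof -
  let ?F = "sequentially \<times>\<^sub>F (at_top :: real filter)"
  define p where "p = (\<lambda>N. a_coef info \<gamma> \<alpha> \<kappa> \<sigma> N \<Gamma>)"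
  define q where "q = (\<lambda>N. spread_coef info \<gamma> \<alpha> \<kappa> \<sigma> N \<Gamma>)"
  \<comment> \<open>The part of E[U]/N that comes from the second moments of the
    preferences.\<close>
  define H where "H = (\<lambda>N. (q N - \<gamma> * (p N + q N)\<^sup>2 - \<alpha> * (2 * p N * q N + (q N)\<^sup>2))
      * ((1 + (real N - 1) * \<sigma>) / real N) + (p N - \<alpha> * (p N)\<^sup>2))"
  \<comment> \<open>The deterministic part of consumption divided by \<open>gbar\<close>.\<close>
  define \<theta> where "\<theta> = (\<lambda>(N, gbar). b_coef \<gamma> \<alpha> \<kappa> N \<Gamma> * (1 - \<omega>bar * mu_coef \<gamma> N \<Gamma> * inverse gbar))"
  obtain p' q' where p: "p \<longlonglongrightarrow> p'" and q: "q \<longlonglongrightarrow> q'"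
    using a_coef_convergent[OF assms(1)] spread_coef_convergent
    unfolding p_def q_def convergent_def by meson
  have "(\<lambda>N. (1 + (real N - 1) * \<sigma>) / real N) \<longlonglongrightarrow> \<sigma>"
    by real_asymp
  then have h: "H \<longlonglongrightarrow> (q' - \<gamma> * (p' + q')\<^sup>2 - \<alpha> * (2 * p' * q' + q'\<^sup>2)) * \<sigma> + (p' - \<alpha> * p'\<^sup>2)"
    (is "_ \<longlonglongrightarrow> ?h") unfolding H_def by (intro tendsto_intros p q)
  have lift: "((\<lambda>x. f (fst x)) \<longlongrightarrow> l) ?F" if "f \<longlonglongrightarrow> l" for f :: "nat \<Rightarrow> real" and l
    by (rule filterlim_compose[OF that filterlim_fst])
  have gbar: "((\<lambda>x. inverse (snd x)) \<longlongrightarrow> 0) ?F"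
    by (rule filterlim_compose[OF tendsto_inverse_0_at_top filterlim_snd]) (rule filterlim_ident)
  have "((\<lambda>x. b_coef \<gamma> \<alpha> \<kappa> (fst x) \<Gamma> * (1 - \<omega>bar * mu_coef \<gamma> (fst x) \<Gamma> * inverse (snd x)))
      \<longlongrightarrow> b * (1 - \<omega>bar * 0 * 0)) ?F"
    unfolding b_def by (intro tendsto_intros gbar lift b_coef_tendsto mu_coef_tendsto)
  then have \<theta>: "(\<theta> \<longlongrightarrow> b) ?F"
    by (simp add: \<theta>_def case_prod_beta')
  have N: "(\<lambda>N. inverse (real N)) \<longlonglongrightarrow> 0"
    by real_asymp
  have "((\<lambda>x. H (fst x) * (inverse (snd x))\<^sup>2 + (\<theta> x - (\<gamma> + \<alpha>) * (\<theta> x)\<^sup>2)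
      - \<gamma> * \<omega>bar * \<theta> x * inverse (snd x) * inverse (real (fst x)))
      \<longlongrightarrow> ?h * 0\<^sup>2 + (b - (\<gamma> + \<alpha>) * b\<^sup>2) - \<gamma> * \<omega>bar * b * 0 * 0) ?F"
    by (intro tendsto_intros gbar \<theta> lift[OF h] lift[OF N])
  then have lim: "((\<lambda>x. H (fst x) * (inverse (snd x))\<^sup>2 + (\<theta> x - (\<gamma> + \<alpha>) * (\<theta> x)\<^sup>2)
      - \<gamma> * \<omega>bar * \<theta> x * inverse (snd x) * inverse (real (fst x)))
      \<longlongrightarrow> b - (\<gamma> + \<alpha>) * b\<^sup>2) ?F"
    by simp
  have ev: "\<forall>\<^sub>F x in ?F. fst x \<ge> 1 \<and> snd x > 0"
    by (intro eventually_conj eventually_compose_filterlim[OF _ filterlim_fst]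
        eventually_compose_filterlim[OF _ filterlim_snd] eventually_ge_at_top eventually_gt_at_top)
  show ?thesis
  \<comment> \<open>The expression with the known limit equals the normalised utility only where the
    model is assumed and the divisions are genuine, that is for \<open>N \<ge> 1\<close> and
    \<open>gbar > 0\<close>.\<close>
  proof (rule Lim_transform_eventually[OF lim], rule eventually_mono[OF ev], clarsimp)
    fix N :: nat and gbar :: real
    assume *: "Suc 0 \<le> N" "0 < gbar"
    interpret consumer_model "M N gbar" N \<sigma> gbar \<omega>bar "g N gbar" "\<omega> N gbar"
      using * by (intro model) auto
    have \<beta>: "b_coef \<gamma> \<alpha> \<kappa> N \<Gamma> * (gbar - \<omega>bar * mu_coef \<gamma> N \<Gamma>) = gbar * \<theta> (N, gbar)"
      using * by (simp add: \<theta>_def field_simps)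
    have "expected_utility info \<gamma> \<alpha> \<kappa> \<sigma> gbar \<omega>bar N \<Gamma> (M N gbar) (g N gbar) (\<omega> N gbar)
      = real N * (H N + (gbar * (gbar * \<theta> (N, gbar)) - (\<gamma> + \<alpha>) * (gbar * \<theta> (N, gbar))\<^sup>2)
        - \<gamma> * (gbar * \<theta> (N, gbar)) * \<omega>bar / real N)"
      using * by (subst expected_utility_eq) (auto simp: \<beta> H_def p_def q_def)
    moreover have "h * (inverse m)\<^sup>2 + (t - c * t\<^sup>2) - \<gamma> * w * t * inverse m * inverse n
        = n * (h + (m * (m * t) - c * (m * t)\<^sup>2) - \<gamma> * (m * t) * w / n) / (n * m\<^sup>2)"
      if "m > 0" "n > 0" for h m n t c w :: real
      using that by (simp add: divide_simps power2_eq_square) (simp add: algebra_simps)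
    ultimately show "H N * (inverse gbar)\<^sup>2 + (\<theta> (N, gbar) - (\<gamma> + \<alpha>) * (\<theta> (N, gbar))\<^sup>2)
        - \<gamma> * \<omega>bar * \<theta> (N, gbar) * inverse gbar * inverse (real N)
      = expected_utility info \<gamma> \<alpha> \<kappa> \<sigma> gbar \<omega>bar N \<Gamma> (M N gbar) (g N gbar) (\<omega> N gbar)
        / (real N * gbar\<^sup>2)"
      using * by simp
  qed
qed

end

section \<open>Comparison of the three behavior models\<close>

theorem corollary7:
  fixes \<gamma> \<alpha> \<kappa> \<sigma> \<omega>bar :: real
    and info :: information
    and M :: "nat \<Rightarrow> real \<Rightarrow> 'a measure"
    and g :: "nat \<Rightarrow> real \<Rightarrow> nat \<Rightarrow> 'a \<Rightarrow> real"
    and \<omega> :: "nat \<Rightarrow> real \<Rightarrow> 'a \<Rightarrow> real"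
    and EU :: "behavior \<Rightarrow> nat \<Rightarrow> real \<Rightarrow> real"
  assumes "\<gamma> > 0" and "\<alpha> > 0" and "\<kappa> > 0" and "0 \<le> \<sigma>" and "\<sigma> \<le> 1"
    and model: "\<And>N gbar. N \<ge> 1 \<Longrightarrow> gbar > 0 \<Longrightarrow>
      consumer_model (M N gbar) N \<sigma> gbar \<omega>bar (g N gbar) (\<omega> N gbar)"
  defines "EU \<equiv> \<lambda>\<Gamma> N gbar.
      expected_utility info \<gamma> \<alpha> \<kappa> \<sigma> gbar \<omega>bar N \<Gamma> (M N gbar) (g N gbar) (\<omega> N gbar)"
  shows
    "((\<lambda>(N, gbar). EU Selfish N gbar / EU Altruistic N gbar) \<longlongrightarrow>
        (4 * \<alpha>\<^sup>2 + 4 * \<alpha> * \<gamma>) / (4 * \<alpha>\<^sup>2 + 4 * \<alpha> * \<gamma> + \<gamma>\<^sup>2)) (sequentially \<times>\<^sub>F at_top)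
     \<and> (4 * \<alpha>\<^sup>2 + 4 * \<alpha> * \<gamma>) / (4 * \<alpha>\<^sup>2 + 4 * \<alpha> * \<gamma> + \<gamma>\<^sup>2) < 1
     \<and> (\<forall>\<^sub>F (N, gbar) in sequentially \<times>\<^sub>F at_top. EU Selfish N gbar < EU Altruistic N gbar)
     \<and> ((\<lambda>(N, gbar). EU Welfare N gbar / EU Altruistic N gbar) \<longlongrightarrow>
        (\<gamma> + \<alpha>) * (2 * \<kappa> + \<alpha> - \<gamma>) / (\<kappa> + \<alpha>)\<^sup>2) (sequentially \<times>\<^sub>F at_top)
     \<and> (\<gamma> \<noteq> \<kappa> \<longrightarrow>
          (\<gamma> + \<alpha>) * (2 * \<kappa> + \<alpha> - \<gamma>) / (\<kappa> + \<alpha>)\<^sup>2 < 1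
          \<and> (\<forall>\<^sub>F (N, gbar) in sequentially \<times>\<^sub>F at_top.
               EU Welfare N gbar / EU Altruistic N gbar < 1))"
proof -
  let ?F = "sequentially \<times>\<^sub>F (at_top :: real filter)"
  define u where "u = (\<lambda>\<Gamma>. let b = inverse (2 * \<alpha> + limit_slope \<gamma> \<kappa> \<Gamma>) in b - (\<gamma> + \<alpha>) * b\<^sup>2)"
  have lim: "((\<lambda>(N, gbar). EU \<Gamma> N gbar / (real N * gbar\<^sup>2)) \<longlongrightarrow> u \<Gamma>) ?F" for \<Gamma>
    unfolding EU_def u_def Let_def
    using assms(1-4) model by (rule expected_utility_asymptotics)
  have u: "u \<Gamma> = (2 * \<alpha> + limit_slope \<gamma> \<kappa> \<Gamma> - (\<gamma> + \<alpha>)) / (2 * \<alpha> + limit_slope \<gamma> \<kappa> \<Gamma>)\<^sup>2" for \<Gamma>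
  proof -
    have "inverse d - c * (inverse d)\<^sup>2 = (d - c) / d\<^sup>2" if "d > 0" for c d :: real
      using that by (simp add: field_simps power2_eq_square)
    then show ?thesis
      using assms(1-3) limit_slope_pos[OF assms(1-3), of \<Gamma>] by (simp add: u_def Let_def)
  qed
  \<comment> \<open>Factors out the 2 so that the squared denominators of the altruistic and welfare
    limits become \<open>4 * (x + \<alpha>)\<^sup>2\<close>, with \<open>x\<close> equal to \<gamma>
    or \<kappa>.\<close>
  have double: "2 * \<alpha> + 2 * x = 2 * (x + \<alpha>)" for x
    by simp
  have uU: "u Altruistic = 1 / (4 * (\<gamma> + \<alpha>))"
    and uS: "u Selfish = \<alpha> / (2 * \<alpha> + \<gamma>)\<^sup>2"
    and uW: "u Welfare = (2 * \<kappa> + \<alpha> - \<gamma>) / (4 * (\<kappa> + \<alpha>)\<^sup>2)"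
    using assms(1-3) unfolding u limit_slope.simps[OF assms(1-3)] double power_mult_distrib
    by (simp_all add: power2_eq_square)
  have uU_pos: "u Altruistic > 0"
    using assms(1-3) by (simp add: uU)
  have ev: "\<forall>\<^sub>F x in ?F. real (fst x) * (snd x)\<^sup>2 > 0"
  proof -
    have "\<forall>\<^sub>F x in ?F. fst x > 0 \<and> snd x > 0"
      by (intro eventually_conj eventually_compose_filterlim[OF _ filterlim_fst]
        eventually_compose_filterlim[OF _ filterlim_snd] eventually_gt_at_top)
    then show ?thesis by eventually_elim simp
  qed
  \<comment> \<open>The common normaliser \<open>N * gbar\<^sup>2\<close> cancels wherever it is
    positive, and the limit of the denominator is nonzero by \<open>uU_pos\<close>.\<close>
  have ratio: "((\<lambda>(N, gbar). EU \<Gamma> N gbar / EU Altruistic N gbar) \<longlongrightarrow> u \<Gamma> / u Altruistic) ?F" for \<Gamma>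
  proof (rule Lim_transform_eventually)
    show "((\<lambda>x. (case x of (N, gbar) \<Rightarrow> EU \<Gamma> N gbar / (real N * gbar\<^sup>2)) /
        (case x of (N, gbar) \<Rightarrow> EU Altruistic N gbar / (real N * gbar\<^sup>2))) \<longlongrightarrow> u \<Gamma> / u Altruistic) ?F"
      using uU_pos by (intro tendsto_divide lim) simp
    show "\<forall>\<^sub>F x in ?F. (case x of (N, gbar) \<Rightarrow> EU \<Gamma> N gbar / (real N * gbar\<^sup>2)) /
        (case x of (N, gbar) \<Rightarrow> EU Altruistic N gbar / (real N * gbar\<^sup>2)) =
        (case x of (N, gbar) \<Rightarrow> EU \<Gamma> N gbar / EU Altruistic N gbar)"
      using ev by eventually_elim (auto split: prod.split)
  qed
  \<comment> \<open>The denominator on the right is \<open>(2 * \<alpha> + \<gamma>)\<^sup>2\<close>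
    expanded; it exceeds the numerator by \<open>\<gamma>\<^sup>2\<close>.\<close>
  have S_eq: "u Selfish / u Altruistic
      = (4 * \<alpha>\<^sup>2 + 4 * \<alpha> * \<gamma>) / (4 * \<alpha>\<^sup>2 + 4 * \<alpha> * \<gamma> + \<gamma>\<^sup>2)"
    unfolding uS uU by (simp add: power2_eq_square algebra_simps)
  have W_eq: "u Welfare / u Altruistic = (\<gamma> + \<alpha>) * (2 * \<kappa> + \<alpha> - \<gamma>) / (\<kappa> + \<alpha>)\<^sup>2"
  proof -
    have "x / (4 * y) / (1 / (4 * z)) = z * x / y" for x y z :: real
      by simp
    then show ?thesis
      unfolding uW uU .
  qed
  have S_less: "(4 * \<alpha>\<^sup>2 + 4 * \<alpha> * \<gamma>) / (4 * \<alpha>\<^sup>2 + 4 * \<alpha> * \<gamma> + \<gamma>\<^sup>2) < 1"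
    using assms(1-3) by (simp add: add_pos_pos)
  have "\<forall>\<^sub>F x in ?F. (case x of (N, gbar) \<Rightarrow> EU Selfish N gbar / (real N * gbar\<^sup>2))
      < (case x of (N, gbar) \<Rightarrow> EU Altruistic N gbar / (real N * gbar\<^sup>2))"
  proof -
    have "u Selfish < u Altruistic"
      using S_less uU_pos by (simp flip: S_eq)
    \<comment> \<open>A level strictly between the two limits eventually separates the normalised
      utilities. Comparing these rather than the ratio with 1 avoids a discussion of the sign of the
      denominator.\<close>
    then obtain c where c: "u Selfish < c" "c < u Altruistic"
      using dense by blast
    show ?thesis
      using order_tendstoD(2)[OF lim c(1)] order_tendstoD(1)[OF lim c(2)]
      by eventually_elim (rule less_trans)
  qed
  then have S_ev: "\<forall>\<^sub>F (N, gbar) in ?F. EU Selfish N gbar < EU Altruistic N gbar"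
    using ev by eventually_elim (auto simp: divide_less_cancel)
  have W: "(\<gamma> + \<alpha>) * (2 * \<kappa> + \<alpha> - \<gamma>) / (\<kappa> + \<alpha>)\<^sup>2 < 1
      \<and> (\<forall>\<^sub>F (N, gbar) in ?F. EU Welfare N gbar / EU Altruistic N gbar < 1)" if "\<gamma> \<noteq> \<kappa>"
  proof -
    \<comment> \<open>The loss from a misjudged parameter is a perfect square, which gives
      strictness exactly when \<kappa> differs from \<gamma>.\<close>
    have "(\<kappa> + \<alpha>)\<^sup>2 - (\<gamma> + \<alpha>) * (2 * \<kappa> + \<alpha> - \<gamma>) = (\<kappa> - \<gamma>)\<^sup>2"
      by (simp add: power2_eq_square algebra_simps)
    moreover have "(\<kappa> - \<gamma>)\<^sup>2 > 0"
      using that by simp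
    ultimately have "(\<gamma> + \<alpha>) * (2 * \<kappa> + \<alpha> - \<gamma>) < (\<kappa> + \<alpha>)\<^sup>2"
      by linarith
    then have less: "(\<gamma> + \<alpha>) * (2 * \<kappa> + \<alpha> - \<gamma>) / (\<kappa> + \<alpha>)\<^sup>2 < 1"
      using assms(1-3) by simp
    then show ?thesis
      using order_tendstoD(2)[OF ratio, of Welfare 1] by (simp add: W_eq case_prod_beta')
  qed
  show ?thesis
    using ratio[of Selfish] ratio[of Welfare] S_less S_ev W unfolding S_eq W_eq by blast
qed

end
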